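(* Consider the forward complete differential inclusion $\dot x(t)\in F(x(t))$ on $\mathbb{R}^n$, where $F$ is a locally Lipschitz set-valued map with nonempty compact values, with locally Lipschitz output maps $h:\mathbb{R}^n\to\mathbb{R}^{p_y}$ and $g:\mathbb{R}^n\to\mathbb{R}^{p_w}$ and continuous proper map $\omega:\mathbb{R}^n\to\mathbb{R}_{\ge 0}$. If the system satisfies the relative measurement to error bounded (RMEB) property and the stability in three measures (SIT) property (with some gain $\rho\in\mathcal{K}$), then it is measurement to error stable (MES).
   Context: Setting. $F$ maps points of $\mathbb{R}^n$ to nonempty compact subsets of $\mathbb{R}^n$. $F$ is locally Lipschitz: every $\xi\in\mathbb{R}^n$ has a neighbourhood $U$ and $L>0$ with $F(\eta)\subseteq F(\zeta)+L|\eta-\zeta|\mathcal{B}$ for all $\eta,\zeta\in U$, where $\mathcal{B}$ is the closed Euclidean unit ball and $|\cdot|$ is the Euclidean norm. A solution of $\dot x\in F(x)$ on $[0,T)$, $0<T\le\infty$, is a function $x:[0,T)\to\mathbb{R}^n$, absolutely continuous on compact subintervals, with $\dot x(t)\in F(x(t))$ for almost every $t$. It is maximal if it has no extension to a solution on $[0,T_+)$ with $T_+>T$. Forward completeness means that every maximal solution is defined for all $t\ge0$. $\mathbf{S}$ is the set of all maximal solutions. Write $|\xi|_\omega:=\omega(\xi)$, $y(t):=h(x(t))$, $w(t):=g(x(t))$, and $\|w\|_{[a,b]}:=\sup_{s\in[a,b]}|w(s)|$. Comparison functions. $\gamma:\mathbb{R}_{\ge0}\to\mathbb{R}_{\ge0}$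 is of class $\mathcal{K}$ if it is continuous, strictly increasing, zero at $0$ and positive elsewhere. $\beta:\mathbb{R}_{\ge0}\times\mathbb{R}_{\ge0}\to\mathbb{R}_{\ge0}$ is of class $\mathcal{KL}$ if $\beta(\cdot,t)\in\mathcal{K}$ for each fixed $t\ge 0$ and, for each fixed $s\ge 0$, $\beta(s,t)$ decreases (is nonincreasing) to $0$ as $t\to\infty$. MES: there exist $\beta\in\mathcal{KL}$ and $\gamma\in\mathcal{K}$ such that $|y(t)|\le\max\{\beta(|x(0)|_\omega,t),\gamma(\|w\|_{[0,t]})\}$ for each $x(\cdot)\in\mathbf{S}$ and all $t\ge0$. SIT with gain $\rho\in\mathcal{K}$: there exists $\beta\in\mathcal{KL}$ such that for every $x(\cdot)\in\mathbf{S}$ and every $t_1>0$ with $|y(t)|>\rho(|w(t)|)$ for all $t\in[0,t_1]$, one has $|y(t)|\le\beta(|x(0)|_\omega,t)$ for all $t\in[0,t_1]$. RMEB: there exist $\rho_1,\sigma_1,\sigma_2\in\mathcal{K}$ such that for every $x(\cdot)\in\mathbf{S}$ and every $t_1>0$ with $|y(t)|>\rho_1(|w(t)|)$ for all $t\in[0,t_1]$, one has $|y(t)|\le\max\{\sigma_1(|h(x(0))|),\sigma_2(\|w\|_{[0,t]})\}$ for all $t\in[0,t_1]$. *)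

theory Defs
  imports "HOL-Analysis.Analysis"
begin

section \<open>Differential inclusions\<close>

definition locally_lipschitz_map :: "(real^'n \<Rightarrow> real^'m) \<Rightarrow> bool" where
  "locally_lipschitz_map f \<longleftrightarrow>
     (\<forall>\<xi>. \<exists>U L. open U \<and> \<xi> \<in> U \<and> L-lipschitz_on U f)"

definition locally_lipschitz_svmap :: "(real^'n \<Rightarrow> (real^'n) set) \<Rightarrow> bool" where
  "locally_lipschitz_svmap F \<longleftrightarrow>
     (\<forall>\<xi>. \<exists>U L. open U \<and> \<xi> \<in> U \<and> L > 0 \<and>
        (\<forall>\<eta>\<in>U. \<forall>\<zeta>\<in>U. F \<eta> \<subseteq> {p + (L * norm (\<eta> - \<zeta>)) *\<^sub>R b | p b. p \<in> F \<zeta> \<and> b \<in> cball 0 1}))"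

text \<open>The usual epsilon-delta definition of absolute continuity on \<open>[a,b]\<close>, over finite families
  of nonoverlapping subintervals. (The library's \<open>absolutely_continuous\<close> is about measures.)\<close>

definition abs_continuous_on :: "real \<Rightarrow> real \<Rightarrow> (real \<Rightarrow> real^'n) \<Rightarrow> bool" where
  "abs_continuous_on a b x \<longleftrightarrow>
     (\<forall>\<epsilon>>0. \<exists>\<delta>>0. \<forall>(N::nat) u v.
        (\<forall>i<N. a \<le> u i \<and> u i \<le> v i \<and> v i \<le> b) \<and>
        disjoint_family_on (\<lambda>i. {u i<..<v i}) {..<N} \<and>
        (\<Sum>i<N. v i - u i) < \<delta>
        \<longrightarrow> (\<Sum>i<N. norm (x (v i) - x (u i))) < \<epsilon>)"

text \<open>A solution on \<open>[0,T)\<close>, where \<open>T = \<infinity>\<close> is allowed, is a total function of which only the values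
  on \<open>[0,T)\<close> matter: the two-sided derivative involves other values only at the single point
  \<open>t = 0\<close>, which is negligible.\<close>

definition solution :: "(real^'n \<Rightarrow> (real^'n) set) \<Rightarrow> ereal \<Rightarrow> (real \<Rightarrow> real^'n) \<Rightarrow> bool" where
  "solution F T x \<longleftrightarrow>
     0 < T \<and>
     (\<forall>a b. 0 \<le> a \<and> a \<le> b \<and> ereal b < T \<longrightarrow> abs_continuous_on a b x) \<and>
     (AE t in lebesgue. 0 \<le> t \<and> ereal t < T \<longrightarrow>
        (\<exists>v\<in>F (x t). (x has_vector_derivative v) (at t)))"

definition maximal_solution :: "(real^'n \<Rightarrow> (real^'n) set) \<Rightarrow> ereal \<Rightarrow> (real \<Rightarrow> real^'n) \<Rightarrow> bool" where
  "maximal_solution F T x \<longleftrightarrow>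
     solution F T x \<and>
     \<not> (\<exists>T' z. T < T' \<and> solution F T' z \<and> (\<forall>t. 0 \<le> t \<and> ereal t < T \<longrightarrow> z t = x t))"

definition forward_complete :: "(real^'n \<Rightarrow> (real^'n) set) \<Rightarrow> bool" where
  "forward_complete F \<longleftrightarrow> (\<forall>T x. maximal_solution F T x \<longrightarrow> T = \<infinity>)"

text \<open>The set \<open>\<^bold>S\<close>. It is used only for forward complete \<open>F\<close>, where \<open>T\<close> is necessarily \<open>\<infinity>\<close>, so that
  dropping \<open>T\<close> loses nothing.\<close>

definition maximal_solutions :: "(real^'n \<Rightarrow> (real^'n) set) \<Rightarrow> (real \<Rightarrow> real^'n) set" where
  "maximal_solutions F = {x. \<exists>T. maximal_solution F T x}"


section \<open>Comparison functions\<close>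

text \<open>Functions on \<open>[0,\<infinity>)\<close> are total functions on the reals, restricted to \<open>{0..}\<close>. That the values
  are nonnegative follows from \<open>\<gamma> 0 = 0\<close> and positivity elsewhere.\<close>

definition class_K :: "(real \<Rightarrow> real) set" where
  "class_K = {\<gamma>. continuous_on {0..} \<gamma> \<and> strict_mono_on {0..} \<gamma> \<and> \<gamma> 0 = 0 \<and> (\<forall>r>0. \<gamma> r > 0)}"

definition class_KL :: "(real \<Rightarrow> real \<Rightarrow> real) set" where
  "class_KL = {\<beta>. (\<forall>t\<ge>0. (\<lambda>s. \<beta> s t) \<in> class_K) \<and>
                  (\<forall>s\<ge>0. antimono_on {0..} (\<beta> s) \<and> (\<beta> s \<longlongrightarrow> 0) at_top)}"


section \<open>Stability properties\<close>

definition sup_norm :: "(real \<Rightarrow> real^'n) \<Rightarrow> real \<Rightarrow> real \<Rightarrow> real" where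
  "sup_norm w a b = (SUP s\<in>{a..b}. norm (w s))"

definition MES ::
  "(real^'n \<Rightarrow> (real^'n) set) \<Rightarrow> (real^'n \<Rightarrow> real^'py) \<Rightarrow> (real^'n \<Rightarrow> real^'pw) \<Rightarrow> (real^'n \<Rightarrow> real) \<Rightarrow> bool"
where
  "MES F h g \<omega> \<longleftrightarrow>
     (\<exists>\<beta>\<in>class_KL. \<exists>\<gamma>\<in>class_K. \<forall>x\<in>maximal_solutions F. \<forall>t\<ge>0.
        norm (h (x t)) \<le> max (\<beta> (\<omega> (x 0)) t) (\<gamma> (sup_norm (\<lambda>s. g (x s)) 0 t)))"

definition SIT ::
  "(real^'n \<Rightarrow> (real^'n) set) \<Rightarrow> (real^'n \<Rightarrow> real^'py) \<Rightarrow> (real^'n \<Rightarrow> real^'pw) \<Rightarrow> (real^'n \<Rightarrow> real)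
     \<Rightarrow> (real \<Rightarrow> real) \<Rightarrow> bool"
where
  "SIT F h g \<omega> \<rho> \<longleftrightarrow>
     (\<exists>\<beta>\<in>class_KL. \<forall>x\<in>maximal_solutions F. \<forall>t\<^sub>1>0.
        (\<forall>t\<in>{0..t\<^sub>1}. norm (h (x t)) > \<rho> (norm (g (x t)))) \<longrightarrow>
        (\<forall>t\<in>{0..t\<^sub>1}. norm (h (x t)) \<le> \<beta> (\<omega> (x 0)) t))"

definition RMEB ::
  "(real^'n \<Rightarrow> (real^'n) set) \<Rightarrow> (real^'n \<Rightarrow> real^'py) \<Rightarrow> (real^'n \<Rightarrow> real^'pw) \<Rightarrow> bool"
where
  "RMEB F h g \<longleftrightarrow>
     (\<exists>\<rho>\<^sub>1\<in>class_K. \<exists>\<sigma>\<^sub>1\<in>class_K. \<exists>\<sigma>\<^sub>2\<in>class_K. \<forall>x\<in>maximal_solutions F. \<forall>t\<^sub>1>0.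
        (\<forall>t\<in>{0..t\<^sub>1}. norm (h (x t)) > \<rho>\<^sub>1 (norm (g (x t)))) \<longrightarrow>
        (\<forall>t\<in>{0..t\<^sub>1}. norm (h (x t)) \<le>
            max (\<sigma>\<^sub>1 (norm (h (x 0)))) (\<sigma>\<^sub>2 (sup_norm (\<lambda>s. g (x s)) 0 t))))"

end

theory Submission
  imports Defs
begin

text \<open>Let \<open>\<rho>\<^sub>0\<close> be the maximum of the gains of SIT and RMEB. If \<open>|y| > \<rho>\<^sub>0(|w|)\<close> holds on all of
  \<open>[0,t]\<close>, SIT bounds \<open>|y(t)|\<close>. Otherwise let \<open>a\<close> be the last time in \<open>[0,t]\<close> at which it fails. For
  \<open>a < s < t\<close> the trajectory restarted at time \<open>s\<close> is again a maximal solution, by forward completeness,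
  and RMEB gives \<open>|y(t)| \<le> max (\<sigma>\<^sub>1(|y(s)|)) (\<sigma>\<^sub>2(\<parallel>w\<parallel>))\<close>. As \<open>s\<close> tends to \<open>a\<close>, this becomes a bound in
  terms of \<open>\<parallel>w\<parallel>\<close> alone, because \<open>|y(a)| \<le> \<rho>\<^sub>0(|w(a)|)\<close>.\<close>

section \<open>Comparison functions: monotonicity, maxima and compositions\<close>

lemma class_K_mono: "\<gamma> \<in> class_K \<Longrightarrow> 0 \<le> a \<Longrightarrow> a \<le> b \<Longrightarrow> \<gamma> a \<le> \<gamma> b"
  unfolding class_K_def
  by (auto dest!: strict_mono_on_imp_mono_on monotone_onD[where x = a and y = b])

lemma class_K_nonneg: "\<gamma> \<in> class_K \<Longrightarrow> 0 \<le> a \<Longrightarrow> 0 \<le> \<gamma> a"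
  using class_K_mono[of \<gamma> 0 a] by (simp add: class_K_def)

lemma class_K_continuous_on: "\<gamma> \<in> class_K \<Longrightarrow> continuous_on {0..} \<gamma>"
  by (simp add: class_K_def)

lemma class_K_max:
  assumes "\<gamma> \<in> class_K" "\<delta> \<in> class_K"
  shows "(\<lambda>r. max (\<gamma> r) (\<delta> r)) \<in> class_K"
proof -
  have "max (\<gamma> r) (\<delta> r) < max (\<gamma> s) (\<delta> s)" if "0 \<le> r" "r < s" for r s
  proof -
    have "\<gamma> r < \<gamma> s" "\<delta> r < \<delta> s"
      using assms that by (auto simp: class_K_def strict_mono_on_def)
    then show ?thesis
      by linarith
  qed
  then show ?thesis
    using assms by (auto simp: class_K_def less_max_iff_disj intro!: continuous_on_max strict_mono_onI)
qed

lemma class_K_compose: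
  assumes "\<gamma> \<in> class_K" "\<delta> \<in> class_K"
  shows "(\<lambda>r. \<gamma> (\<delta> r)) \<in> class_K"
proof -
  have "continuous_on {0..} (\<lambda>r. \<gamma> (\<delta> r))"
    using class_K_nonneg[OF assms(2)]
    by (intro continuous_on_compose2[OF class_K_continuous_on[OF assms(1)]]
        class_K_continuous_on[OF assms(2)]) auto
  moreover have "strict_mono_on {0..} (\<lambda>r. \<gamma> (\<delta> r))"
    using assms class_K_nonneg[OF assms(2)] by (auto simp: class_K_def strict_mono_on_def)
  ultimately show ?thesis
    using assms by (auto simp: class_K_def)
qed

section \<open>Continuity of the output maps and of trajectories\<close>

lemma locally_lipschitz_map_continuous_on:
  assumes "locally_lipschitz_map f"
  shows "continuous_on A f"
proof -
  have "isCont f \<xi>" for \<xi>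
  proof -
    obtain U L where "open U" "\<xi> \<in> U" "L-lipschitz_on U f"
      using assms unfolding locally_lipschitz_map_def by blast
    then show ?thesis
      using lipschitz_on_continuous_on continuous_on_eq_continuous_at by blast
  qed
  then show ?thesis
    by (simp add: continuous_at_imp_continuous_on)
qed

text \<open>Families consisting of a single interval suffice: for \<open>N = 1\<close> the
  epsilon-delta condition is uniform continuity on \<open>{a..b}\<close>.\<close>

lemma abs_continuous_on_imp_continuous_on:
  assumes "abs_continuous_on a b x"
  shows "continuous_on {a..b} x"
  unfolding continuous_on_iff
proof (intro ballI allI impI)
  fix s \<epsilon> :: real
  assume s: "s \<in> {a..b}" and "0 < \<epsilon>"
  then obtain \<delta> where "\<delta> > 0" and \<delta>: "\<And>(N::nat) u v.
      (\<forall>i<N. a \<le> u i \<and> u i \<le> v i \<and> v i \<le> b) \<Longrightarrow>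
      disjoint_family_on (\<lambda>i. {u i<..<v i}) {..<N} \<Longrightarrow> (\<Sum>i<N. v i - u i) < \<delta> \<Longrightarrow>
      (\<Sum>i<N. norm (x (v i) - x (u i))) < \<epsilon>"
    using assms unfolding abs_continuous_on_def by meson
  have close: "norm (x q - x p) < \<epsilon>" if "a \<le> p" "p \<le> q" "q \<le> b" "q - p < \<delta>" for p q
    using \<delta>[of 1 "\<lambda>_. p" "\<lambda>_. q"] that by (auto simp: disjoint_family_on_def)
  have "dist (x r) (x s) < \<epsilon>" if "r \<in> {a..b}" "dist r s < \<delta>" for r
    using close[of r s] close[of s r] that s
    by (cases "r \<le> s") (auto simp: dist_norm norm_minus_commute)
  with \<open>\<delta> > 0\<close> show "\<exists>d>0. \<forall>r\<in>{a..b}. dist r s < d \<longrightarrow> dist (x r) (x s) < \<epsilon>"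
    by blast
qed

section \<open>Time shifts of trajectories\<close>

lemma abs_continuous_on_shift:
  assumes "abs_continuous_on (a + s) (b + s) x"
  shows "abs_continuous_on a b (\<lambda>t. x (t + s))"
  unfolding abs_continuous_on_def
proof (intro allI impI)
  fix \<epsilon> :: real
  assume "0 < \<epsilon>"
  then obtain \<delta> where "\<delta> > 0" and \<delta>: "\<And>(N::nat) u v.
      (\<forall>i<N. a + s \<le> u i \<and> u i \<le> v i \<and> v i \<le> b + s) \<Longrightarrow>
      disjoint_family_on (\<lambda>i. {u i<..<v i}) {..<N} \<Longrightarrow> (\<Sum>i<N. v i - u i) < \<delta> \<Longrightarrow>
      (\<Sum>i<N. norm (x (v i) - x (u i))) < \<epsilon>"
    using assms unfolding abs_continuous_on_def by meson
  have "(\<Sum>i<N. norm (x (v i + s) - x (u i + s))) < \<epsilon>"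
    if uv: "\<forall>i<N. a \<le> u i \<and> u i \<le> v i \<and> v i \<le> b"
      and disj: "disjoint_family_on (\<lambda>i. {u i<..<v i}) {..<N}" and "(\<Sum>i<N. v i - u i) < \<delta>"
    for N :: nat and u v
  proof (rule \<delta>)
    \<comment> \<open>Translation preserves lengths, so the \<open>\<delta>\<close> obtained for
      \<open>x\<close> serves unchanged. A common point \<open>r\<close> of two shifted intervals
      would yield the common point \<open>r - s\<close> of the original ones.\<close>
    show "disjoint_family_on (\<lambda>i. {u i + s<..<v i + s}) {..<N}"
      unfolding disjoint_family_on_def
    proof (intro ballI impI)
      fix i j
      assume "i \<in> {..<N}" "j \<in> {..<N}" "i \<noteq> j"
      then have "{u i<..<v i} \<inter> {u j<..<v j} = {}"
        using disj by (simp add: disjoint_family_on_def)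
      then have "r - s \<notin> {u i<..<v i} \<or> r - s \<notin> {u j<..<v j}" for r
        by blast
      then show "{u i + s<..<v i + s} \<inter> {u j + s<..<v j + s} = {}"
        by (fastforce simp: algebra_simps)
    qed
  qed (use that in auto)
  with \<open>\<delta> > 0\<close> show "\<exists>\<delta>>0. \<forall>(N::nat) u v.
      (\<forall>i<N. a \<le> u i \<and> u i \<le> v i \<and> v i \<le> b) \<and> disjoint_family_on (\<lambda>i. {u i<..<v i}) {..<N} \<and>
      (\<Sum>i<N. v i - u i) < \<delta> \<longrightarrow> (\<Sum>i<N. norm (x (v i + s) - x (u i + s))) < \<epsilon>"
    by blast
qed

text \<open>The exceptional set moves by \<open>- s\<close>, and translates of negligible sets are
  negligible.\<close>

lemma AE_lebesgue_shift:
  fixes s :: "'a::euclidean_space"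
  assumes "AE t in lebesgue. P t"
  shows "AE t in lebesgue. P (t + s)"
proof -
  obtain N where N: "N \<in> null_sets lebesgue" "{t. \<not> P t} \<subseteq> N"
    using assms by (auto simp: eventually_ae_filter)
  have "(+) (- s) ` N \<in> null_sets lebesgue"
    using N(1) negligible_translation unfolding negligible_iff_null_sets[symmetric] by blast
  moreover have "{t. \<not> P (t + s)} \<subseteq> (+) (- s) ` N"
  proof
    fix t
    assume "t \<in> {t. \<not> P (t + s)}"
    then have "t + s \<in> N" "t = - s + (t + s)"
      using N(2) by auto
    then show "t \<in> (+) (- s) ` N"
      by blast
  qed
  ultimately show ?thesis
    by (auto simp: eventually_ae_filter)
qed

lemma has_vector_derivative_shift:
  assumes "(x has_vector_derivative v) (at (t + s))"
  shows "((\<lambda>t. x (t + s)) has_vector_derivative v) (at (t::real))"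
proof -
  have "((\<lambda>t. t + s) has_vector_derivative 1) (at t)"
    by (auto intro!: derivative_eq_intros)
  from vector_diff_chain_at[OF this assms] show ?thesis
    by (simp add: o_def)
qed

text \<open>The inclusion is autonomous, so the condition on the derivative at \<open>t\<close> for
  the shifted function is the one for \<open>x\<close> at \<open>t + s\<close>; since
  \<open>0 \<le> s\<close>, this time stays in the domain.\<close>

lemma solution_shift:
  assumes x: "solution F \<infinity> x" and s: "0 \<le> s"
  shows "solution F \<infinity> (\<lambda>t. x (t + s))"
proof -
  have "abs_continuous_on a b (\<lambda>t. x (t + s))" if "0 \<le> a" "a \<le> b" for a b
    using that x s by (intro abs_continuous_on_shift) (auto simp: solution_def)
  moreover have "AE t in lebesgue. 0 \<le> t \<longrightarrow> (\<exists>v\<in>F (x t). (x has_vector_derivative v) (at t))"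
    using x by (simp add: solution_def)
  from AE_lebesgue_shift[OF this, of s]
  have "AE t in lebesgue. 0 \<le> t \<longrightarrow>
      (\<exists>v\<in>F (x (t + s)). ((\<lambda>t. x (t + s)) has_vector_derivative v) (at t))"
    by eventually_elim (use s has_vector_derivative_shift in fastforce)
  ultimately show ?thesis
    by (simp add: solution_def)
qed

text \<open>No time exceeds \<open>\<infinity>\<close>, so a solution on the whole half-line cannot
  be extended; forward completeness gives the converse. Together with \<open>solution_shift\<close>
  this makes restarted trajectories maximal again.\<close>

lemma maximal_solutions_forward_complete:
  assumes "forward_complete F"
  shows "x \<in> maximal_solutions F \<longleftrightarrow> solution F \<infinity> x"
  using assms
  by (force simp: maximal_solutions_def maximal_solution_def forward_complete_def)

lemma solution_continuous_on:
  assumes "solution F \<infinity> x" "0 \<le> a"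
  shows "continuous_on {a..b} x"
  using assms by (cases "a \<le> b") (auto simp: solution_def intro!: abs_continuous_on_imp_continuous_on)

section \<open>Supremum norms on compact time intervals\<close>

lemma sup_norm_upper:
  assumes "continuous_on {a..b} w" "s \<in> {a..b}"
  shows "norm (w s) \<le> sup_norm w a b"
  unfolding sup_norm_def
proof (rule cSUP_upper)
  \<comment> \<open>A real \<open>SUP\<close> is known to dominate the values only if they are
    bounded above; compactness of the interval provides this.\<close>
  have "compact ((\<lambda>s. norm (w s)) ` {a..b})"
    using assms(1) by (intro compact_continuous_image continuous_intros) auto
  then show "bdd_above ((\<lambda>s. norm (w s)) ` {a..b})"
    by (intro bounded_imp_bdd_above compact_imp_bounded)
qed (fact assms(2))

lemma sup_norm_shift_le:
  assumes "continuous_on {0..t} w" "0 \<le> s" "s \<le> t"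
  shows "sup_norm (\<lambda>r. w (r + s)) 0 (t - s) \<le> sup_norm w 0 t"
  unfolding sup_norm_def[of "\<lambda>r. w (r + s)"]
  using assms by (intro cSUP_least sup_norm_upper) auto

section \<open>Combining SIT and RMEB into MES\<close>

theorem lemma5p2:
  fixes F :: "real^'n \<Rightarrow> (real^'n) set"
    and h :: "real^'n \<Rightarrow> real^'py"
    and g :: "real^'n \<Rightarrow> real^'pw"
    and \<omega> :: "real^'n \<Rightarrow> real"
  assumes "\<And>\<xi>. F \<xi> \<noteq> {}" and "\<And>\<xi>. compact (F \<xi>)"
    and "locally_lipschitz_svmap F"
    and "forward_complete F"
    and "locally_lipschitz_map h"
    and "locally_lipschitz_map g"
    and "\<And>\<xi>. \<omega> \<xi> \<ge> 0"
    and "continuous_on UNIV \<omega>"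
    and "proper_map euclidean (top_of_set {0..}) \<omega>"
    and "RMEB F h g"
    and "\<exists>\<rho>\<in>class_K. SIT F h g \<omega> \<rho>"
  shows "MES F h g \<omega>"
proof -
  obtain \<rho> where \<rho>: "\<rho> \<in> class_K" and SIT: "SIT F h g \<omega> \<rho>"
    using assms(11) by blast
  obtain \<beta> where \<beta>: "\<beta> \<in> class_KL"
    and "\<forall>x\<in>maximal_solutions F. \<forall>t\<^sub>1>0.
        (\<forall>t\<in>{0..t\<^sub>1}. norm (h (x t)) > \<rho> (norm (g (x t)))) \<longrightarrow>
        (\<forall>t\<in>{0..t\<^sub>1}. norm (h (x t)) \<le> \<beta> (\<omega> (x 0)) t)"
    using SIT unfolding SIT_def by (elim bexE)
  note sit = this(2)[THEN bspec, THEN spec, THEN mp, THEN mp, THEN bspec]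
  obtain \<rho>\<^sub>1 \<sigma>\<^sub>1 \<sigma>\<^sub>2 where K: "\<rho>\<^sub>1 \<in> class_K" "\<sigma>\<^sub>1 \<in> class_K" "\<sigma>\<^sub>2 \<in> class_K"
    and "\<forall>x\<in>maximal_solutions F. \<forall>t\<^sub>1>0.
        (\<forall>t\<in>{0..t\<^sub>1}. norm (h (x t)) > \<rho>\<^sub>1 (norm (g (x t)))) \<longrightarrow>
        (\<forall>t\<in>{0..t\<^sub>1}. norm (h (x t)) \<le>
            max (\<sigma>\<^sub>1 (norm (h (x 0)))) (\<sigma>\<^sub>2 (sup_norm (\<lambda>s. g (x s)) 0 t)))"
    using assms(10) unfolding RMEB_def by (elim bexE)
  note rmeb = this(4)[THEN bspec, THEN spec, THEN mp, THEN mp, THEN bspec]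
  define \<rho>\<^sub>0 where "\<rho>\<^sub>0 = (\<lambda>r. max (\<rho> r) (\<rho>\<^sub>1 r))"
  \<comment> \<open>The terms cover the case of a failure at \<open>t\<close> itself
    (\<open>\<rho>\<^sub>0\<close>), the limit of the restarted initial outputs
    (\<open>\<sigma>\<^sub>1\<close> after \<open>\<rho>\<^sub>0\<close>), and the measurement term
    of RMEB (\<open>\<sigma>\<^sub>2\<close>).\<close>
  define \<gamma> where "\<gamma> = (\<lambda>r. max (\<rho>\<^sub>0 r) (max (\<sigma>\<^sub>1 (\<rho>\<^sub>0 r)) (\<sigma>\<^sub>2 r)))"
  have \<rho>\<^sub>0: "\<rho>\<^sub>0 \<in> class_K"
    unfolding \<rho>\<^sub>0_def by (intro class_K_max \<rho> K)
  have \<gamma>: "\<gamma> \<in> class_K"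
    unfolding \<gamma>_def by (intro class_K_max \<rho>\<^sub>0 K class_K_compose[OF K(2) \<rho>\<^sub>0])
  have "norm (h (x t)) \<le> max (\<beta> (\<omega> (x 0)) t) (\<gamma> (sup_norm (\<lambda>s. g (x s)) 0 t))"
    if x: "x \<in> maximal_solutions F" and t: "0 \<le> t" for x t
  proof -
    have sol: "solution F \<infinity> x"
      using x maximal_solutions_forward_complete[OF assms(4)] by blast
    define y where "y = (\<lambda>s. norm (h (x s)))"
    define w where "w = (\<lambda>s. g (x s))"
    define M where "M = sup_norm w 0 t"
    have cont_y: "continuous_on {0..b} y" for b
      unfolding y_def
      by (intro continuous_on_norm continuous_on_compose2[OF locally_lipschitz_map_continuous_on[OF assms(5)]]
          solution_continuous_on[OF sol]) auto
    have cont_w: "continuous_on {0..b} w" for b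
      unfolding w_def
      by (intro continuous_on_compose2[OF locally_lipschitz_map_continuous_on[OF assms(6)]]
          solution_continuous_on[OF sol]) auto
    have cont_d: "continuous_on {0..b} (\<lambda>s. y s - \<rho>\<^sub>0 (norm (w s)))" for b
      by (intro continuous_on_diff cont_y
          continuous_on_compose2[OF class_K_continuous_on[OF \<rho>\<^sub>0]] continuous_on_norm cont_w) auto
    have w_le: "norm (w s) \<le> M" if "s \<in> {0..t}" for s
      unfolding M_def by (intro sup_norm_upper cont_w that)
    show ?thesis
    proof (cases "\<forall>s\<in>{0..t}. y s > \<rho>\<^sub>0 (norm (w s))")
      case True
      \<comment> \<open>SIT speaks only of intervals with \<open>t\<^sub>1 > 0\<close>. For
        \<open>t = 0\<close> the strict inequality at \<open>0\<close> therefore has to be extended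
        to a short interval by continuity.\<close>
      have "\<exists>t\<^sub>1>0. t \<le> t\<^sub>1 \<and> (\<forall>s\<in>{0..t\<^sub>1}. y s > \<rho>\<^sub>0 (norm (w s)))"
      proof (cases "t = 0")
        case t0: True
        define d where "d = (\<lambda>s. y s - \<rho>\<^sub>0 (norm (w s)))"
        have "d 0 > 0"
          using True t0 by (simp add: d_def)
        then obtain \<delta> where "\<delta> > 0" and \<delta>: "\<And>s. s \<in> {0..1} \<Longrightarrow> dist s 0 < \<delta> \<Longrightarrow> dist (d s) (d 0) < d 0"
          using cont_d[of 1, folded d_def, unfolded continuous_on_iff, rule_format, of 0 "d 0"] by auto
        have "y s > \<rho>\<^sub>0 (norm (w s))" if "s \<in> {0..min 1 (\<delta> / 2)}" for s
        proof -
          have "dist (d s) (d 0) < d 0"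
            using that \<open>\<delta> > 0\<close> by (intro \<delta>) auto
          then show ?thesis
            by (simp add: d_def dist_real_def)
        qed
        with \<open>\<delta> > 0\<close> t0 show ?thesis
          by (intro exI[of _ "min 1 (\<delta> / 2)"]) auto
      next
        case False
        with True t show ?thesis
          by (intro exI[of _ t]) auto
      qed
      then obtain t\<^sub>1 where "t\<^sub>1 > 0" "t \<le> t\<^sub>1" "\<forall>s\<in>{0..t\<^sub>1}. y s > \<rho> (norm (w s))"
        by (auto simp: \<rho>\<^sub>0_def)
      with sit[OF x, of t\<^sub>1 t] t have "norm (h (x t)) \<le> \<beta> (\<omega> (x 0)) t"
        by (simp add: y_def w_def)
      then show ?thesis
        by simp
    next
      case False
      \<comment> \<open>The set of failure times in \<open>[0,t]\<close>. It is the preimage of a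
        closed half-line under a continuous function, hence compact, so a last failure time
        \<open>a\<close> exists.\<close>
      define C where "C = {0..t} \<inter> (\<lambda>s. y s - \<rho>\<^sub>0 (norm (w s))) -` {..0}"
      have "compact C"
        unfolding compact_eq_bounded_closed
      proof
        show "bounded C"
          unfolding C_def by (rule bounded_subset[of "{0..t}"]) auto
        show "closed C"
          unfolding C_def by (intro continuous_closed_preimage cont_d) auto
      qed
      moreover have "C \<noteq> {}"
      proof -
        obtain s where "s \<in> {0..t}" "\<not> y s > \<rho>\<^sub>0 (norm (w s))"
          using False by blast
        then have "s \<in> C"
          by (simp add: C_def)
        then show ?thesis
          by blast
      qed
      ultimately obtain a where "a \<in> C" and max: "\<And>s. s \<in> C \<Longrightarrow> s \<le> a"
        using compact_attains_sup[of C] by blast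
      then have a: "0 \<le> a" "a \<le> t" "y a \<le> \<rho>\<^sub>0 (norm (w a))"
        by (auto simp: C_def)
      have ya: "y a \<le> \<rho>\<^sub>0 M"
        using a by (intro order_trans[OF a(3) class_K_mono[OF \<rho>\<^sub>0 norm_ge_zero w_le]]) simp
      \<comment> \<open>A violation after \<open>a\<close> would lie in \<open>C\<close>, as
        \<open>\<rho>\<^sub>1\<close> is at most \<open>\<rho>\<^sub>0\<close>, contradicting the
        maximality of \<open>a\<close>.\<close>
      have above: "y s > \<rho>\<^sub>1 (norm (w s))" if "a < s" "s \<le> t" for s
        using max[of s] a that by (force simp: C_def \<rho>\<^sub>0_def)
      have "y t \<le> \<gamma> M"
      proof (cases "a = t")
        case True
        with ya show ?thesis
          by (simp add: \<gamma>_def)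
      next
        case False
        with a have "a < t" by simp
        \<comment> \<open>The restart happens strictly after \<open>a\<close>: RMEB requires the
          strict inequality at its initial time too, and at \<open>a\<close> it need not
          hold.\<close>
        have bound: "y t \<le> max (\<sigma>\<^sub>1 (y s)) (\<sigma>\<^sub>2 M)" if s: "a < s" "s < t" for s
        proof -
          have shift: "(\<lambda>r. x (r + s)) \<in> maximal_solutions F"
            using solution_shift[OF sol, of s] s a maximal_solutions_forward_complete[OF assms(4)] by auto
          have "y t \<le> max (\<sigma>\<^sub>1 (y s)) (\<sigma>\<^sub>2 (sup_norm (\<lambda>r. w (r + s)) 0 (t - s)))"
            using rmeb[OF shift, of "t - s" "t - s"] above s by (simp add: y_def w_def)
          moreover have "\<sigma>\<^sub>2 (sup_norm (\<lambda>r. w (r + s)) 0 (t - s)) \<le> \<sigma>\<^sub>2 M"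
          proof (rule class_K_mono[OF K(3)])
            \<comment> \<open>Monotonicity of \<open>\<sigma>\<^sub>2\<close> is available only on
              nonnegative arguments; the supremum is nonnegative because it dominates the norm at
              the initial time.\<close>
            have "continuous_on {0..t - s} (\<lambda>r. w (r + s))"
              using s a by (intro continuous_on_compose2[OF cont_w[of t]] continuous_intros) auto
            then have "norm (w (0 + s)) \<le> sup_norm (\<lambda>r. w (r + s)) 0 (t - s)"
              by (rule sup_norm_upper) (use s in auto)
            then show "0 \<le> sup_norm (\<lambda>r. w (r + s)) 0 (t - s)"
              by (rule order_trans[OF norm_ge_zero])
            show "sup_norm (\<lambda>r. w (r + s)) 0 (t - s) \<le> M"
              unfolding M_def using s a by (intro sup_norm_shift_le cont_w) auto
          qed
          ultimately show ?thesis
            by linarith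
        qed
        \<comment> \<open>The bound holds for every \<open>s\<close> in \<open>(a,t)\<close> with a
          right-hand side continuous up to \<open>a\<close>, so the non-strict inequality survives
          the limit from the right.\<close>
        have "continuous_on {a..t} (\<lambda>s. max (\<sigma>\<^sub>1 (y s)) (\<sigma>\<^sub>2 M))"
          using a by (intro continuous_on_max continuous_on_const
              continuous_on_compose2[OF class_K_continuous_on[OF K(2)]]
              continuous_on_subset[OF cont_y[of t]]) (auto simp: y_def)
        then have "((\<lambda>s. max (\<sigma>\<^sub>1 (y s)) (\<sigma>\<^sub>2 M)) \<longlongrightarrow> max (\<sigma>\<^sub>1 (y a)) (\<sigma>\<^sub>2 M)) (at_right a)"
          using \<open>a < t\<close> by (rule continuous_on_Icc_at_rightD)
        moreover have "\<forall>\<^sub>F s in at_right a. y t \<le> max (\<sigma>\<^sub>1 (y s)) (\<sigma>\<^sub>2 M)"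
          using bound \<open>a < t\<close> unfolding eventually_at_right_field by blast
        ultimately have "y t \<le> max (\<sigma>\<^sub>1 (y a)) (\<sigma>\<^sub>2 M)"
          by (rule tendsto_lowerbound) simp
        moreover have "\<sigma>\<^sub>1 (y a) \<le> \<sigma>\<^sub>1 (\<rho>\<^sub>0 M)"
          by (rule class_K_mono[OF K(2) _ ya]) (simp add: y_def)
        ultimately show ?thesis
          unfolding \<gamma>_def by linarith
      qed
      then show ?thesis
        by (simp add: y_def w_def M_def)
    qed
  qed
  then show ?thesis
    unfolding MES_def by (intro bexI[OF _ \<beta>] bexI[OF _ \<gamma>] ballI allI impI)
qed

end
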